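(* Let $X$ be an $L$-convex space. Then the $L$-convex space $X^F$ together with the mapping $\xi_X:X\to X^F$, $\xi_X(x)=co_X(1_x)$, is a sobrification of $X$.
   Context: Throughout, $(L,\otimes)$ is a complete residuated lattice: $L$ is a complete lattice with bottom $0$ and top $1$, $(L,\otimes,1)$ is a commutative monoid, and $a\otimes\bigvee S=\bigvee_{s\in S}(a\otimes s)$ for all $a\in L$, $S\subseteq L$; the operation $\to$ is determined by $a\otimes b\le c\iff a\le b\to c$. An $L$-subset of a set $X$ is a map $A:X\to L$; $L^X$ is the set of all of them, ordered pointwise, with pointwise joins, meets and $(a\to C)(x)=a\to C(x)$. $a_X$ is the constant $L$-subset with value $a$. $A$ is nonempty if $\bigvee_{x\in X}A(x)=1$. For $x\in X$, $1_x\in L^X$ takes value $1$ at $x$ and $0$ elsewhere; for $Z\subseteq X$, $\chi_Z\in L^X$ takes value $1$ on $Z$ and $0$ off $Z$. ${\rm sub}(A,B)=\bigwedge_{x\in X}(A(x)\to B(x))$. A subset of a poset is directed if it is nonempty and any two of its elements have an upper bound in it; $\bigvee^{\uparrow}$ denotes the join of a directed family. An $L$-convex structure on $X$ is a family $\mathcal C\subseteq L^X$ with: (C1) $0_X,1_X\in\mathcal C$; (C2) $\mathcal C$ is closed under joins of directed subsets; (C3) $\mathcal C$ is closed under arbitrary meets; (C4) $a\to C\in\mathcal C$ for all $a\in L$, $C\in\mathcal C$. Then $X=(X,\mathcal C)$ is an $L$-convex space, $\mathcal C=\mathcal C(X)$, and members of $\mathcal C(X)$ are convex sets. The hull operator is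 $co_X(A)=\bigwedge\{B\in\mathcal C(X)\mid A\le B\}$ for $A\in L^X$. A map $f:X\to Y$ between $L$-convex spaces is convexity-preserving if $B\circ f\in\mathcal C(X)$ for every $B\in\mathcal C(Y)$. $F\in L^X$ is finite if ${\rm sub}(F,\bigvee^{\uparrow}_{i}A_i)=\bigvee^{\uparrow}_i{\rm sub}(F,A_i)$ for every directed family $\{A_i\}\subseteq L^X$. $X$ is sober if for every nonempty finite $F\in L^X$ there is a unique $x\in X$ with $co_X(F)=co_X(1_x)$. A convex set $K$ of $X$ is compact if $\bigvee_{x\in X}K(x)=1$ and ${\rm sub}(K,\bigvee^{\uparrow}_iC_i)=\bigvee^{\uparrow}_i{\rm sub}(K,C_i)$ for every directed family $\{C_i\}\subseteq\mathcal C(X)$. ${\rm cp}(\mathcal C(X))$ is the set of compact convex sets of $X$. For $A\in\mathcal C(X)$, $\phi(A):{\rm cp}(\mathcal C(X))\to L$ is $\phi(A)(K)={\rm sub}(K,A)$. ${\rm Cp}(\mathcal C(X))$ denotes the set ${\rm cp}(\mathcal C(X))$ with the $L$-convex structure $\{\phi(A)\mid A\in\mathcal C(X)\}$. A subset $A\subseteq X$ of an $L$-convex space is F-closed if for every nonempty finite $L$-subset $F\in L^X$ and every $x\in X$, $F\le\chi_A$ and $co_X(F)=co_X(1_x)$ imply $x\in A$. The F-closure ${\rm cl}_{\mathfrak F}(B)$ of $B\subseteq X$ is the intersection of all F-closed sets containing $B$. $\Theta(X)=\{co_X(1_x)\mid x\in X\}$, and $X^F$ is the F-closure of $\Theta(X)$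 in ${\rm Cp}(\mathcal C(X))$. For $A\in\mathcal C(X)$, $\varphi(A)=\phi(A)|_{X^F}$; $X^F$ is equipped with the $L$-convex structure $\mathcal C(X^F)=\{\varphi(A)\mid A\in\mathcal C(X)\}$. Sobrification: for an $L$-convex space $X$, a sober $L$-convex space $Y$ and a convexity-preserving map $j:X\to Y$, the pair $(Y,j)$ is a sobrification of $X$ if for every sober $L$-convex space $Z$ and every convexity-preserving map $f:X\to Z$ there is a unique convexity-preserving map $\overline f:Y\to Z$ with $f=\overline f\circ j$. *)

theory Defs
  imports Main "HOL-Library.FuncSet"
begin

section \<open>Complete residuated lattices\<close>

text \<open>
  The monoid operation is \<open>*\<close>, its unit \<open>1\<close> is the top element, and the least element is \<open>bot\<close>.
\<close>

class complete_residuated_lattice = complete_lattice + comm_monoid_mult +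
  fixes residuum :: "'a \<Rightarrow> 'a \<Rightarrow> 'a"
  assumes one_eq_top: "1 = top"
    and mult_Sup: "a * Sup S = (SUP s\<in>S. a * s)"
    and residuation: "a * b \<le> c \<longleftrightarrow> a \<le> residuum b c"


section \<open>L-subsets\<close>

text \<open>
  An L-subset of a carrier set \<open>X\<close> is a function that is \<open>undefined\<close> outside \<open>X\<close>, so that equality
  and the order \<open>\<le>\<close> of functions agree with equality and the pointwise order on \<open>X\<close>.
\<close>

definition lsubsets :: "'a set \<Rightarrow> ('a \<Rightarrow> 'l) set" where
  "lsubsets X = (X \<rightarrow>\<^sub>E UNIV)"

definition lconst :: "'a set \<Rightarrow> 'l \<Rightarrow> 'a \<Rightarrow> 'l" where
  "lconst X a = (\<lambda>x\<in>X. a)"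

definition lJoin :: "'a set \<Rightarrow> ('a \<Rightarrow> 'l::complete_lattice) set \<Rightarrow> 'a \<Rightarrow> 'l" where
  "lJoin X S = (\<lambda>x\<in>X. SUP A\<in>S. A x)"

definition lMeet :: "'a set \<Rightarrow> ('a \<Rightarrow> 'l::complete_lattice) set \<Rightarrow> 'a \<Rightarrow> 'l" where
  "lMeet X S = (\<lambda>x\<in>X. INF A\<in>S. A x)"

definition lresiduum ::
  "'a set \<Rightarrow> 'l::complete_residuated_lattice \<Rightarrow> ('a \<Rightarrow> 'l) \<Rightarrow> 'a \<Rightarrow> 'l" where
  "lresiduum X a C = (\<lambda>x\<in>X. residuum a (C x))"

definition lchar :: "'a set \<Rightarrow> 'a set \<Rightarrow> 'a \<Rightarrow> 'l::complete_residuated_lattice" where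
  "lchar X Z = (\<lambda>x\<in>X. if x \<in> Z then 1 else bot)"

definition lpoint :: "'a set \<Rightarrow> 'a \<Rightarrow> 'a \<Rightarrow> 'l::complete_residuated_lattice" where
  "lpoint X x = (\<lambda>y\<in>X. if y = x then 1 else bot)"

definition lnonempty :: "'a set \<Rightarrow> ('a \<Rightarrow> 'l::complete_residuated_lattice) \<Rightarrow> bool" where
  "lnonempty X A \<longleftrightarrow> (SUP x\<in>X. A x) = 1"

definition lsub ::
  "'a set \<Rightarrow> ('a \<Rightarrow> 'l::complete_residuated_lattice) \<Rightarrow> ('a \<Rightarrow> 'l) \<Rightarrow> 'l" where
  "lsub X A B = (INF x\<in>X. residuum (A x) (B x))"

definition directed_set :: "'p::order set \<Rightarrow> bool" where
  "directed_set D \<longleftrightarrow> D \<noteq> {} \<and> (\<forall>a\<in>D. \<forall>b\<in>D. \<exists>c\<in>D. a \<le> c \<and> b \<le> c)"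

text \<open>Directed families are represented by their sets of members, which determine the joins.\<close>

definition lfinite :: "'a set \<Rightarrow> ('a \<Rightarrow> 'l::complete_residuated_lattice) \<Rightarrow> bool" where
  "lfinite X F \<longleftrightarrow> F \<in> lsubsets X \<and>
     (\<forall>D \<subseteq> lsubsets X. directed_set D \<longrightarrow> lsub X F (lJoin X D) = (SUP A\<in>D. lsub X F A))"


section \<open>L-convex spaces\<close>

record ('a, 'l) lconv =
  points :: "'a set"
  convex_sets :: "('a \<Rightarrow> 'l) set"

definition lconvex_space :: "('a, 'l::complete_residuated_lattice) lconv \<Rightarrow> bool" where
  "lconvex_space X \<longleftrightarrow>
     convex_sets X \<subseteq> lsubsets (points X) \<and>
     lconst (points X) bot \<in> convex_sets X \<and>
     lconst (points X) 1 \<in> convex_sets X \<and>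
     (\<forall>D \<subseteq> convex_sets X. directed_set D \<longrightarrow> lJoin (points X) D \<in> convex_sets X) \<and>
     (\<forall>S \<subseteq> convex_sets X. lMeet (points X) S \<in> convex_sets X) \<and>
     (\<forall>a. \<forall>C \<in> convex_sets X. lresiduum (points X) a C \<in> convex_sets X)"

definition hull ::
  "('a, 'l::complete_residuated_lattice) lconv \<Rightarrow> ('a \<Rightarrow> 'l) \<Rightarrow> 'a \<Rightarrow> 'l" where
  "hull X A = lMeet (points X) {B \<in> convex_sets X. A \<le> B}"

text \<open>
  Maps between spaces are functions that are \<open>undefined\<close> outside the source, so that
  uniqueness of a map refers to its values on the points only.
\<close>

definition convexity_preserving ::
  "('a, 'l) lconv \<Rightarrow> ('b, 'l) lconv \<Rightarrow> ('a \<Rightarrow> 'b) \<Rightarrow> bool" where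
  "convexity_preserving X Y f \<longleftrightarrow>
     f \<in> points X \<rightarrow>\<^sub>E points Y \<and>
     (\<forall>B \<in> convex_sets Y. compose (points X) B f \<in> convex_sets X)"

definition sober :: "('a, 'l::complete_residuated_lattice) lconv \<Rightarrow> bool" where
  "sober X \<longleftrightarrow> lconvex_space X \<and>
     (\<forall>F. lfinite (points X) F \<and> lnonempty (points X) F \<longrightarrow>
        (\<exists>!x. x \<in> points X \<and> hull X F = hull X (lpoint (points X) x)))"


section \<open>Compact convex sets\<close>

definition compact_convex ::
  "('a, 'l::complete_residuated_lattice) lconv \<Rightarrow> ('a \<Rightarrow> 'l) set" where
  "compact_convex X = {K \<in> convex_sets X.
     (SUP x\<in>points X. K x) = 1 \<and>
     (\<forall>D \<subseteq> convex_sets X. directed_set D \<longrightarrow>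
        lsub (points X) K (lJoin (points X) D) = (SUP C\<in>D. lsub (points X) K C))}"

definition phi ::
  "('a, 'l::complete_residuated_lattice) lconv \<Rightarrow> ('a \<Rightarrow> 'l) \<Rightarrow> ('a \<Rightarrow> 'l) \<Rightarrow> 'l" where
  "phi X A = (\<lambda>K\<in>compact_convex X. lsub (points X) K A)"

definition Cp :: "('a, 'l::complete_residuated_lattice) lconv \<Rightarrow> ('a \<Rightarrow> 'l, 'l) lconv" where
  "Cp X = \<lparr>points = compact_convex X, convex_sets = phi X ` convex_sets X\<rparr>"


section \<open>F-closure and the space \<open>X\<^sup>F\<close>\<close>

definition F_closed :: "('a, 'l::complete_residuated_lattice) lconv \<Rightarrow> 'a set \<Rightarrow> bool" where
  "F_closed X A \<longleftrightarrow> A \<subseteq> points X \<and>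
     (\<forall>F. \<forall>x\<in>points X.
        lfinite (points X) F \<and> lnonempty (points X) F \<and> F \<le> lchar (points X) A \<and>
        hull X F = hull X (lpoint (points X) x) \<longrightarrow> x \<in> A)"

definition F_closure :: "('a, 'l::complete_residuated_lattice) lconv \<Rightarrow> 'a set \<Rightarrow> 'a set" where
  "F_closure X B = \<Inter> {A. F_closed X A \<and> B \<subseteq> A}"

definition Theta :: "('a, 'l::complete_residuated_lattice) lconv \<Rightarrow> ('a \<Rightarrow> 'l) set" where
  "Theta X = {hull X (lpoint (points X) x) | x. x \<in> points X}"

definition XF_points :: "('a, 'l::complete_residuated_lattice) lconv \<Rightarrow> ('a \<Rightarrow> 'l) set" where
  "XF_points X = F_closure (Cp X) (Theta X)"

definition XF :: "('a, 'l::complete_residuated_lattice) lconv \<Rightarrow> ('a \<Rightarrow> 'l, 'l) lconv" where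
  "XF X = \<lparr>points = XF_points X,
           convex_sets = (\<lambda>A. restrict (phi X A) (XF_points X)) ` convex_sets X\<rparr>"

definition xi ::
  "('a, 'l::complete_residuated_lattice) lconv \<Rightarrow> 'a \<Rightarrow> 'a \<Rightarrow> 'l" where
  "xi X = (\<lambda>x\<in>points X. hull X (lpoint (points X) x))"


section \<open>Sobrification\<close>

text \<open>
  A formula cannot quantify over types, so the type of the points of the test spaces \<open>Z\<close> is a
  parameter; a statement about \<open>TYPE('z)\<close> with \<open>'z\<close> free covers all test spaces.
\<close>

definition sobrification ::
  "'z itself \<Rightarrow> ('a, 'l::complete_residuated_lattice) lconv \<Rightarrow> ('b, 'l) lconv \<Rightarrow> ('a \<Rightarrow> 'b) \<Rightarrow> bool"
where
  "sobrification (_ :: 'z itself) X Y j \<longleftrightarrow>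
     lconvex_space X \<and> sober Y \<and> convexity_preserving X Y j \<and>
     (\<forall>(Z :: ('z, 'l) lconv) f. sober Z \<and> convexity_preserving X Z f \<longrightarrow>
        (\<exists>!g. convexity_preserving Y Z g \<and> f = compose (points X) g j))"

end

theory Submission
  imports Defs
begin

text \<open>
  For convex \<open>A\<close> the hull satisfies \<open>sub(co F, A) = sub(F, A)\<close>, so \<open>co F = co G\<close> holds iff
  \<open>sub(F, A) = sub(G, A)\<close> for all convex \<open>A\<close>; as \<open>sub(1\<^sub>x, A) = A x\<close>, sobriety says that
  each nonempty finite \<open>F\<close> has a unique \<open>x\<close> with \<open>sub(F, A) = A x\<close> for all convex \<open>A\<close>.

  A nonempty finite \<open>L\<close>-subset \<open>F\<close> of \<open>X\<^sup>F\<close> is represented by the hull \<open>K\<close> of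
  \<open>\<Squnion>\<^sub>M F M * M\<close>: this \<open>K\<close> is compact with \<open>sub(K, A) = sub(F, \<phi> A)\<close>, and it lies in
  \<open>X\<^sup>F\<close> because \<open>X\<^sup>F\<close> is F-closed. A map \<open>f : X \<rightarrow> Z\<close> into a sober space can only extend by
  sending \<open>K\<close> to a point \<open>z\<close> with \<open>B z = sub(K, B \<circ> f)\<close> for all convex \<open>B\<close>. The set of all
  \<open>K\<close> that admit such a \<open>z\<close> contains \<open>\<Theta>(X)\<close>, and it is F-closed because the push-forward of
  a nonempty finite \<open>L\<close>-subset to \<open>Z\<close> is again nonempty and finite; so it contains \<open>X\<^sup>F\<close>.
\<close>

section \<open>Residuated lattices and the subsethood degree\<close>

lemma le_residuum_iff:
  "(a::'l::complete_residuated_lattice) \<le> residuum b c \<longleftrightarrow> a * b \<le> c"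
  by (simp add: residuation)

lemma mult_bot_right: "(a::'l::complete_residuated_lattice) * bot = bot"
  using mult_Sup[of a "{}"] by simp

lemma mult_SUP: "(a::'l::complete_residuated_lattice) * (SUP i\<in>I. f i) = (SUP i\<in>I. a * f i)"
  using mult_Sup[of a "f ` I"] by (simp add: image_comp o_def)

lemma le_one: "(a::'l::complete_residuated_lattice) \<le> 1"
  by (simp add: one_eq_top)

text \<open>Equalities of subsethood degrees are proved by comparing lower bounds:
  \<open>a \<le> lsub X A B\<close> unfolds by residuation to pointwise inequalities, which are easy
  to compare.\<close>

lemma eqI_lower: "(\<And>a. a \<le> u \<longleftrightarrow> a \<le> v) \<Longrightarrow> u = (v::'l::order)"
  by (meson order.eq_iff)

lemma mult_SUP_le_iff:
  "(a::'l::complete_residuated_lattice) * (SUP i\<in>I. f i) \<le> c \<longleftrightarrow> (\<forall>i\<in>I. a * f i \<le> c)"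
  by (simp add: mult_SUP SUP_le_iff)

lemma le_lsub_iff: "a \<le> lsub X A B \<longleftrightarrow> (\<forall>x\<in>X. a * A x \<le> B x)"
  by (simp add: lsub_def le_INF_iff le_residuum_iff)

lemma lsub_mult_le: "x \<in> X \<Longrightarrow> lsub X A B * A x \<le> B x"
  using le_lsub_iff[of "lsub X A B" X A B] by simp

lemma lsub_mono: "(\<And>x. x \<in> X \<Longrightarrow> B x \<le> C x) \<Longrightarrow> lsub X A B \<le> lsub X A C"
  by (auto simp: le_lsub_iff intro: order_trans[OF lsub_mult_le])

lemma lsub_cong:
  "(\<And>x. x \<in> X \<Longrightarrow> A x = A' x) \<Longrightarrow> (\<And>x. x \<in> X \<Longrightarrow> B x = B' x) \<Longrightarrow> lsub X A B = lsub X A' B'"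
  by (simp add: lsub_def)

lemma lsub_lpoint: "x \<in> X \<Longrightarrow> lsub X (lpoint X x) A = A x"
  by (rule eqI_lower) (auto simp: le_lsub_iff lpoint_def mult_bot_right)

lemma lsub_lMeet: "lsub X A (lMeet X S) = (INF B\<in>S. lsub X A B)"
  by (rule eqI_lower) (auto simp: le_lsub_iff lMeet_def le_INF_iff)

lemma lsub_lresiduum: "lsub X A (lresiduum X a B) = residuum a (lsub X A B)"
  by (rule eqI_lower) (auto simp: le_lsub_iff lresiduum_def le_residuum_iff ac_simps)

lemma lsub_lconst_one: "lsub X A (lconst X 1) = 1"
  by (rule antisym) (auto simp: le_lsub_iff lconst_def le_one)

text \<open>Multiplication distributes over the join of the values of \<open>A\<close>, and this
  join is the unit. Nonemptiness of compact sets thus makes \<open>phi\<close> preserve the constant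
  \<open>bot\<close>.\<close>

lemma lsub_lconst_bot:
  assumes "lnonempty X A"
  shows "lsub X A (lconst X bot) = bot"
proof -
  have "lsub X A (lconst X bot) * A x \<le> bot" if "x \<in> X" for x
    using lsub_mult_le[OF that, of A "lconst X bot"] that by (simp add: lconst_def)
  then have "lsub X A (lconst X bot) * (SUP x\<in>X. A x) \<le> bot"
    unfolding mult_SUP_le_iff by blast
  then show ?thesis
    using assms by (simp add: lnonempty_def bot_unique)
qed

section \<open>Pointwise order and equality of L-subsets\<close>

lemma lsubsets_eqI:
  "A \<in> lsubsets X \<Longrightarrow> B \<in> lsubsets X \<Longrightarrow> (\<And>x. x \<in> X \<Longrightarrow> A x = B x) \<Longrightarrow> A = B"
  by (rule extensionalityI[of A X]) (auto simp: lsubsets_def PiE_def)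

lemma lsubsets_leI:
  fixes A B :: "'a \<Rightarrow> 'l::order"
  assumes "A \<in> lsubsets X" "B \<in> lsubsets X" "\<And>x. x \<in> X \<Longrightarrow> A x \<le> B x"
  shows "A \<le> B"
proof (rule le_funI)
  show "A x \<le> B x" for x
    by (cases "x \<in> X") (use assms in \<open>auto simp: lsubsets_def PiE_def extensional_def\<close>)
qed

lemma restrict_in_lsubsets [simp]: "restrict A X \<in> lsubsets X"
  by (simp add: lsubsets_def)

lemma lJoin_in_lsubsets [simp]: "lJoin X D \<in> lsubsets X"
  by (simp add: lJoin_def)

lemma lMeet_in_lsubsets [simp]: "lMeet X D \<in> lsubsets X"
  by (simp add: lMeet_def)

lemma lpoint_in_lsubsets [simp]: "lpoint X x \<in> lsubsets X"
  by (simp add: lpoint_def)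

section \<open>Directed sets along order-preserving and order-reflecting maps\<close>

lemma directed_set_image:
  assumes D: "directed_set D" and T: "\<And>A B. A \<in> D \<Longrightarrow> B \<in> D \<Longrightarrow> A \<le> B \<Longrightarrow> T A \<le> T B"
  shows "directed_set (T ` D)"
proof -
  have "\<exists>C\<in>D. T A \<le> T C \<and> T B \<le> T C" if "A \<in> D" "B \<in> D" for A B
    using D T that unfolding directed_set_def by meson
  then show ?thesis
    using D by (simp add: directed_set_def)
qed

lemma directed_set_vimage:
  assumes D: "directed_set (T ` D)" and T: "\<And>A B. A \<in> D \<Longrightarrow> B \<in> D \<Longrightarrow> T A \<le> T B \<Longrightarrow> A \<le> B"
  shows "directed_set D"
proof -
  have "\<exists>C\<in>D. A \<le> C \<and> B \<le> C" if "A \<in> D" "B \<in> D" for A B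
  proof -
    have "\<exists>c\<in>T ` D. T A \<le> c \<and> T B \<le> c"
      using D that by (simp add: directed_set_def)
    then obtain C where "C \<in> D" "T A \<le> T C" "T B \<le> T C"
      by blast
    then show ?thesis
      using T that by blast
  qed
  then show ?thesis
    using D by (simp add: directed_set_def)
qed

section \<open>Finite L-subsets\<close>

lemma lfinite_lpoint: "x \<in> X \<Longrightarrow> lfinite X (lpoint X x)"
  by (simp add: lfinite_def lsub_lpoint) (simp add: lJoin_def)

lemma lnonempty_lpoint: "x \<in> X \<Longrightarrow> lnonempty X (lpoint X x :: _ \<Rightarrow> 'l::complete_residuated_lattice)"
  unfolding lnonempty_def
  by (rule antisym[OF le_one]) (rule SUP_upper2[of x], auto simp: lpoint_def)

text \<open>The forward image of \<open>F\<close> along a map \<open>g\<close> that matters only on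
  \<open>S\<close>. Both uses have \<open>F\<close> supported in \<open>S\<close>: extension by
  \<open>bot\<close> (with \<open>g = id\<close>) and transport along a map chosen only on
  \<open>S\<close>.\<close>

definition lpush ::
  "'a set \<Rightarrow> ('a \<Rightarrow> 'b) \<Rightarrow> 'b set \<Rightarrow> ('a \<Rightarrow> 'l::complete_residuated_lattice) \<Rightarrow> 'b \<Rightarrow> 'l" where
  "lpush S g Y F = (\<lambda>y\<in>Y. SUP x\<in>{x\<in>S. g x = y}. F x)"

lemma lpush_in_lsubsets [simp]: "lpush S g Y F \<in> lsubsets Y"
  by (simp add: lpush_def)

context
  fixes S X :: "'a set" and g :: "'a \<Rightarrow> 'b" and Y :: "'b set"
    and F :: "'a \<Rightarrow> 'l::complete_residuated_lattice"
  assumes sub: "S \<subseteq> X" and maps: "g ` S \<subseteq> Y" and supp: "\<And>x. x \<in> X - S \<Longrightarrow> F x = bot"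
begin

text \<open>Image and preimage are adjoint: testing the image of \<open>F\<close> against
  \<open>B\<close> is testing \<open>F\<close> against \<open>B\<close> after \<open>g\<close>.
  Points outside \<open>S\<close> contribute \<open>a * bot = bot\<close>, which is no
  constraint.\<close>

lemma lsub_lpush:
  assumes "\<And>x. x \<in> S \<Longrightarrow> B (g x) = A x"
  shows "lsub Y (lpush S g Y F) B = lsub X F A"
proof (rule eqI_lower)
  fix a :: 'l
  have "a \<le> lsub Y (lpush S g Y F) B \<longleftrightarrow> (\<forall>x\<in>S. a * F x \<le> B (g x))"
    using maps by (auto simp: le_lsub_iff lpush_def mult_SUP_le_iff)
  also have "\<dots> \<longleftrightarrow> a \<le> lsub X F A"
    using assms sub supp by (auto simp: le_lsub_iff) (metis Diff_iff bot_least mult_bot_right)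
  finally show "a \<le> lsub Y (lpush S g Y F) B \<longleftrightarrow> a \<le> lsub X F A" .
qed

lemma lnonempty_lpush:
  assumes "lnonempty X F"
  shows "lnonempty Y (lpush S g Y F)"
proof -
  have "F x \<le> (SUP y\<in>Y. lpush S g Y F y)" if "x \<in> X" for x
  proof (cases "x \<in> S")
    case True
    then have "F x \<le> lpush S g Y F (g x)" "g x \<in> Y"
      using maps by (auto simp: lpush_def intro!: SUP_upper)
    then show ?thesis
      by (meson SUP_upper2)
  qed (use supp that in simp)
  then have "(SUP x\<in>X. F x) \<le> (SUP y\<in>Y. lpush S g Y F y)"
    by (rule SUP_least)
  then show ?thesis
    using assms le_one antisym unfolding lnonempty_def by metis
qed

lemma lfinite_lpush:
  assumes "lfinite X F"
  shows "lfinite Y (lpush S g Y F)"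
  unfolding lfinite_def
proof (intro conjI allI impI)
  fix D :: "('b \<Rightarrow> 'l) set"
  assume D: "D \<subseteq> lsubsets Y" "directed_set D"
  \<comment> \<open>\<open>T B\<close> is the preimage of \<open>B\<close> under \<open>g\<close>.
    It preserves directedness and, on \<open>S\<close>, joins, so finiteness of \<open>F\<close>
    transfers. Its value off \<open>S\<close> does not affect the degree, since \<open>F\<close> is
    \<open>bot\<close> there.\<close>
  define T where "T B = (\<lambda>x\<in>X. if x \<in> S then B (g x) else bot)" for B :: "'b \<Rightarrow> 'l"
  have T: "lsub Y (lpush S g Y F) B = lsub X F (T B)" for B
    by (rule lsub_lpush) (use sub in \<open>auto simp: T_def\<close>)
  have "directed_set (T ` D)"
    by (rule directed_set_image[OF D(2)]) (auto simp: T_def le_fun_def)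
  moreover have "T ` D \<subseteq> lsubsets X"
    by (auto simp: T_def)
  ultimately have "lsub X F (lJoin X (T ` D)) = (SUP A\<in>T ` D. lsub X F A)"
    using assms by (simp add: lfinite_def)
  moreover have "lsub Y (lpush S g Y F) (lJoin Y D) = lsub X F (lJoin X (T ` D))"
  proof (rule lsub_lpush)
    fix x assume "x \<in> S"
    then show "lJoin Y D (g x) = lJoin X (T ` D) x"
      using sub maps by (auto simp: lJoin_def T_def image_comp o_def)
  qed
  ultimately show "lsub Y (lpush S g Y F) (lJoin Y D) = (SUP A\<in>D. lsub Y (lpush S g Y F) A)"
    by (simp add: T image_comp o_def)
qed simp

end

section \<open>Hulls and sobriety\<close>

context
  fixes X :: "('a, 'l::complete_residuated_lattice) lconv"
  assumes X: "lconvex_space X"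
begin

lemma convex_in_lsubsets: "A \<in> convex_sets X \<Longrightarrow> A \<in> lsubsets (points X)"
  using X by (auto simp: lconvex_space_def)

lemma lJoin_convex:
  "D \<subseteq> convex_sets X \<Longrightarrow> directed_set D \<Longrightarrow> lJoin (points X) D \<in> convex_sets X"
  using X by (auto simp: lconvex_space_def)

lemma lMeet_convex: "S \<subseteq> convex_sets X \<Longrightarrow> lMeet (points X) S \<in> convex_sets X"
  using X by (auto simp: lconvex_space_def)

lemma lresiduum_convex: "C \<in> convex_sets X \<Longrightarrow> lresiduum (points X) a C \<in> convex_sets X"
  using X by (auto simp: lconvex_space_def)

lemma hull_convex: "hull X F \<in> convex_sets X"
  unfolding hull_def by (rule lMeet_convex) auto

lemma hull_least: "B \<in> convex_sets X \<Longrightarrow> F \<le> B \<Longrightarrow> hull X F \<le> B"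
  by (rule lsubsets_leI[of _ "points X"])
    (auto simp: hull_def convex_in_lsubsets, auto simp: lMeet_def intro: INF_lower)

lemma hull_upper: "F \<in> lsubsets (points X) \<Longrightarrow> F \<le> hull X F"
  by (rule lsubsets_leI[of _ "points X"])
    (auto simp: hull_def, auto simp: lMeet_def le_fun_def intro: INF_greatest)

text \<open>A degree \<open>a\<close> lies below \<open>lsub (points X) G A\<close> iff
  \<open>G\<close> lies below \<open>lresiduum (points X) a A\<close>. The latter is convex, so it
  contains \<open>F\<close> iff it contains the hull of \<open>F\<close>.\<close>

lemma lsub_hull:
  assumes F: "F \<in> lsubsets (points X)" and A: "A \<in> convex_sets X"
  shows "lsub (points X) (hull X F) A = lsub (points X) F A"
proof (rule eqI_lower)
  fix a :: 'l
  have *: "a \<le> lsub (points X) G A \<longleftrightarrow> G \<le> lresiduum (points X) a A"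
    if "G \<in> lsubsets (points X)" for G
  proof
    assume "a \<le> lsub (points X) G A"
    then show "G \<le> lresiduum (points X) a A"
      using that by (intro lsubsets_leI[of _ "points X"])
        (auto simp: le_lsub_iff lresiduum_def le_residuum_iff ac_simps)
  next
    assume "G \<le> lresiduum (points X) a A"
    then show "a \<le> lsub (points X) G A"
      unfolding le_lsub_iff le_fun_def lresiduum_def
      by (metis le_residuum_iff mult.commute restrict_apply')
  qed
  have "hull X F \<le> lresiduum (points X) a A \<longleftrightarrow> F \<le> lresiduum (points X) a A"
    using hull_upper[OF F] hull_least lresiduum_convex[OF A] order_trans by blast
  then show "a \<le> lsub (points X) (hull X F) A \<longleftrightarrow> a \<le> lsub (points X) F A"
    using * F hull_convex convex_in_lsubsets by blast
qed

lemma lsub_hull_lpoint: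
  "x \<in> points X \<Longrightarrow> A \<in> convex_sets X \<Longrightarrow> lsub (points X) (hull X (lpoint (points X) x)) A = A x"
  by (simp add: lsub_hull lsub_lpoint)

text \<open>A Yoneda argument: testing against \<open>K'\<close> gives degree 1 to the inclusion of
  \<open>K\<close> in \<open>K'\<close>, and testing against \<open>K\<close> gives the
  converse.\<close>

lemma convex_eqI:
  assumes K: "K \<in> convex_sets X" "K' \<in> convex_sets X"
    and eq: "\<And>A. A \<in> convex_sets X \<Longrightarrow> lsub (points X) K A = lsub (points X) K' A"
  shows "K = K'"
proof -
  have le: "G \<le> H" if "G \<in> convex_sets X" "H \<in> convex_sets X"
    "lsub (points X) G H = lsub (points X) H H" for G H
  proof -
    have "1 \<le> lsub (points X) G H"
      by (simp add: that(3) le_lsub_iff)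
    then show ?thesis
      using that(1,2) by (intro lsubsets_leI[of _ "points X"]) (auto simp: le_lsub_iff convex_in_lsubsets)
  qed
  show ?thesis
    by (rule antisym; rule le) (use K eq in \<open>auto\<close>)
qed

lemma hull_eq_iff:
  assumes "F \<in> lsubsets (points X)" "G \<in> lsubsets (points X)"
  shows "hull X F = hull X G \<longleftrightarrow>
    (\<forall>A\<in>convex_sets X. lsub (points X) F A = lsub (points X) G A)"
  by (metis assms convex_eqI hull_convex lsub_hull)

lemma hull_eq_hull_lpoint_iff:
  assumes "F \<in> lsubsets (points X)" "x \<in> points X"
  shows "hull X F = hull X (lpoint (points X) x) \<longleftrightarrow>
    (\<forall>A\<in>convex_sets X. lsub (points X) F A = A x)"
  using assms by (simp add: hull_eq_iff lsub_lpoint)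

text \<open>Passing to the hull keeps degrees against convex sets. The assumption \<open>fin\<close>
  speaks of directed families of convex sets only, because a weighted join of compact sets is known
  to commute just with these.\<close>

lemma hull_compact_convex:
  assumes F: "F \<in> lsubsets (points X)" "lnonempty (points X) F"
    and fin: "\<And>D. D \<subseteq> convex_sets X \<Longrightarrow> directed_set D \<Longrightarrow>
      lsub (points X) F (lJoin (points X) D) = (SUP C\<in>D. lsub (points X) F C)"
  shows "hull X F \<in> compact_convex X"
proof -
  have "(SUP x\<in>points X. F x) \<le> (SUP x\<in>points X. hull X F x)"
    using hull_upper[OF F(1)] by (intro SUP_mono) (auto simp: le_fun_def)
  then have "(SUP x\<in>points X. hull X F x) = 1"
    using F(2) le_one antisym unfolding lnonempty_def by metis
  moreover have "lsub (points X) (hull X F) (lJoin (points X) D) =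
      (SUP C\<in>D. lsub (points X) (hull X F) C)" if D: "D \<subseteq> convex_sets X" "directed_set D" for D
  proof -
    have "(SUP C\<in>D. lsub (points X) (hull X F) C) = (SUP C\<in>D. lsub (points X) F C)"
      using D(1) by (intro SUP_cong) (auto simp: lsub_hull F)
    then show ?thesis
      using fin[OF D] by (simp add: lsub_hull F lJoin_convex D)
  qed
  ultimately show ?thesis
    by (simp add: compact_convex_def hull_convex)
qed

lemma Theta_subset_compact_convex: "Theta X \<subseteq> compact_convex X"
proof -
  have "hull X (lpoint (points X) x) \<in> compact_convex X" if "x \<in> points X" for x
    by (rule hull_compact_convex)
      (use that in \<open>simp_all add: lnonempty_lpoint lsub_lpoint\<close>, simp add: lJoin_def)
  then show ?thesis
    by (auto simp: Theta_def)
qed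

end

lemma sober_lconvex_space: "sober Z \<Longrightarrow> lconvex_space Z"
  by (simp add: sober_def)

lemma sober_point:
  assumes "sober Z" "lfinite (points Z) F" "lnonempty (points Z) F"
  obtains z where "z \<in> points Z" "\<And>B. B \<in> convex_sets Z \<Longrightarrow> lsub (points Z) F B = B z"
proof -
  have "F \<in> lsubsets (points Z)"
    using assms(2) by (simp add: lfinite_def)
  then show thesis
    using assms that hull_eq_hull_lpoint_iff[OF sober_lconvex_space[OF assms(1)]]
    unfolding sober_def by blast
qed

text \<open>The convex sets of a sober space separate points: \<open>y\<close> and \<open>z\<close>
  would both represent the finite L-subset \<open>lpoint (points Z) y\<close>.\<close>

lemma sober_point_eqI:
  assumes "sober Z" "y \<in> points Z" "z \<in> points Z" "\<And>B. B \<in> convex_sets Z \<Longrightarrow> B y = B z"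
  shows "y = z"
proof -
  let ?F = "lpoint (points Z) y :: _ \<Rightarrow> 'b"
  have "hull Z ?F = hull Z (lpoint (points Z) z)"
    using assms by (simp add: hull_eq_hull_lpoint_iff sober_lconvex_space lsub_lpoint)
  moreover have "lfinite (points Z) ?F" "lnonempty (points Z) ?F"
    using assms(2) by (simp_all add: lfinite_lpoint lnonempty_lpoint)
  ultimately show ?thesis
    using assms(1-3) unfolding sober_def by blast
qed

section \<open>Spaces of compact convex sets\<close>

text \<open>A common form of \<open>Cp X\<close> and \<open>XF X\<close>, so that convexity and the
  hull criterion are proved once, for any \<open>P\<close> between \<open>Theta X\<close> and
  \<open>compact_convex X\<close>.\<close>

definition phi_space ::
  "('a, 'l::complete_residuated_lattice) lconv \<Rightarrow> ('a \<Rightarrow> 'l) set \<Rightarrow> ('a \<Rightarrow> 'l, 'l) lconv" where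
  "phi_space X P = \<lparr>points = P, convex_sets = (\<lambda>A. restrict (phi X A) P) ` convex_sets X\<rparr>"

lemma points_phi_space [simp]: "points (phi_space X P) = P"
  by (simp add: phi_space_def)

lemma Cp_eq_phi_space: "Cp X = phi_space X (compact_convex X)"
  by (simp add: Cp_def phi_space_def phi_def)

lemma XF_eq_phi_space: "XF X = phi_space X (XF_points X)"
  by (simp add: XF_def phi_space_def)

text \<open>F-closed sets are stable under intersection because \<open>lchar\<close> is monotone in
  the set: an L-subset supported in the closure is supported in every F-closed set above
  \<open>B\<close>.\<close>

lemma F_closed_F_closure:
  assumes "B \<subseteq> points Y"
  shows "F_closed Y (F_closure Y B)"
proof -
  have "F_closed Y (points Y)"
    by (simp add: F_closed_def)
  then have *: "F_closure Y B \<subseteq> points Y"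
    using assms by (auto simp: F_closure_def)
  have "x \<in> A" if "lfinite (points Y) F" "lnonempty (points Y) F"
    "F \<le> lchar (points Y) (F_closure Y B)" "hull Y F = hull Y (lpoint (points Y) x)"
    "x \<in> points Y" "F_closed Y A" "B \<subseteq> A" for F x A
  proof -
    have "F_closure Y B \<subseteq> A"
      using that by (auto simp: F_closure_def)
    then have "lchar (points Y) (F_closure Y B) \<le> (lchar (points Y) A :: _ \<Rightarrow> 'b)"
      by (auto simp: lchar_def le_fun_def)
    then show ?thesis
      using that order_trans unfolding F_closed_def by blast
  qed
  then have "x \<in> F_closure Y B" if "lfinite (points Y) F" "lnonempty (points Y) F"
    "F \<le> lchar (points Y) (F_closure Y B)" "hull Y F = hull Y (lpoint (points Y) x)"
    "x \<in> points Y" for F x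
    using that by (subst F_closure_def) blast
  with * show ?thesis
    unfolding F_closed_def by blast
qed

lemma subset_F_closure: "B \<subseteq> F_closure Y B"
  by (auto simp: F_closure_def)

lemma F_closure_least: "F_closed Y A \<Longrightarrow> B \<subseteq> A \<Longrightarrow> F_closure Y B \<subseteq> A"
  by (auto simp: F_closure_def)

context
  fixes X :: "('a, 'l::complete_residuated_lattice) lconv"
  assumes X: "lconvex_space X"
begin

text \<open>For each \<open>K\<close> in \<open>P\<close> the map \<open>lsub (points X) K\<close>
  preserves the constants, meets and residua, and by compactness directed joins of convex sets, so
  the convexity axioms carry over from \<open>X\<close>.\<close>

lemma phi_space_lconvex_space:
  assumes P: "Theta X \<subseteq> P" "P \<subseteq> compact_convex X"
  shows "lconvex_space (phi_space X P)"
proof -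
  define \<Phi> where "\<Phi> A = restrict (phi X A) P" for A
  have \<Phi>: "\<Phi> A K = lsub (points X) K A" if "K \<in> P" for A K
    using that P(2) by (auto simp: \<Phi>_def phi_def)
  have \<Phi>_in [simp]: "\<Phi> A \<in> lsubsets P" for A
    by (simp add: \<Phi>_def)
  have convex_sets_eq: "convex_sets (phi_space X P) = \<Phi> ` convex_sets X"
    by (simp add: phi_space_def \<Phi>_def)
  have "lconst P bot = \<Phi> (lconst (points X) bot)"
    by (rule lsubsets_eqI[of _ P])
      (use P in \<open>auto simp: lconst_def[of P] \<Phi> lsub_lconst_bot lnonempty_def compact_convex_def\<close>)
  moreover have "lconst P 1 = \<Phi> (lconst (points X) 1)"
    by (rule lsubsets_eqI[of _ P]) (auto simp: lconst_def[of P] \<Phi> lsub_lconst_one)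
  moreover have "lconst (points X) bot \<in> convex_sets X" "lconst (points X) 1 \<in> convex_sets X"
    using X by (simp_all add: lconvex_space_def)
  moreover have "lJoin P D \<in> \<Phi> ` convex_sets X"
    if D: "D \<subseteq> \<Phi> ` convex_sets X" "directed_set D" for D
  proof -
    obtain E where E: "E \<subseteq> convex_sets X" "D = \<Phi> ` E"
      using D(1) by (meson subset_imageE)
    \<comment> \<open>The values at the hulls of points recover \<open>A\<close>, and
      \<open>P\<close> contains these hulls. So \<Phi> reflects the order, and a directed family of
      images comes from a directed family of convex sets.\<close>
    have "directed_set E"
    proof (rule directed_set_vimage)
      show "directed_set (\<Phi> ` E)"
        using D(2) E(2) by simp
      fix A B assume AB: "A \<in> E" "B \<in> E" "\<Phi> A \<le> \<Phi> B"
      show "A \<le> B"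
      proof (rule lsubsets_leI[of _ "points X"])
        fix x assume x: "x \<in> points X"
        then have "hull X (lpoint (points X) x) \<in> P"
          using P(1) by (auto simp: Theta_def)
        with AB x E(1) show "A x \<le> B x"
          by (metis \<Phi> le_fun_def lsub_hull_lpoint[OF X x] subsetD)
      qed (use AB E(1) convex_in_lsubsets[OF X] in auto)
    qed
    moreover have "lJoin P D = \<Phi> (lJoin (points X) E)"
      by (rule lsubsets_eqI[of _ P])
        (use calculation P(2) E in
          \<open>auto simp: lJoin_def[of P] \<Phi> compact_convex_def image_comp o_def\<close>)
    ultimately show ?thesis
      using E(1) lJoin_convex[OF X] by blast
  qed
  moreover have "lMeet P S \<in> \<Phi> ` convex_sets X" if S: "S \<subseteq> \<Phi> ` convex_sets X" for S
  proof -
    obtain E where E: "E \<subseteq> convex_sets X" "S = \<Phi> ` E"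
      using S by (meson subset_imageE)
    have "lMeet P S = \<Phi> (lMeet (points X) E)"
      by (rule lsubsets_eqI[of _ P])
        (auto simp: lMeet_def[of P] \<Phi> lsub_lMeet E(2) image_comp o_def)
    then show ?thesis
      using E(1) lMeet_convex[OF X] by blast
  qed
  moreover have "lresiduum P a (\<Phi> C) \<in> \<Phi> ` convex_sets X" if "C \<in> convex_sets X" for a C
  proof -
    have "lresiduum P a (\<Phi> C) = \<Phi> (lresiduum (points X) a C)"
      by (rule lsubsets_eqI[of _ P]) (auto simp: lresiduum_def[of P] \<Phi> lsub_lresiduum)
    then show ?thesis
      using that lresiduum_convex[OF X] by blast
  qed
  ultimately show ?thesis
    by (auto simp: lconvex_space_def convex_sets_eq)
qed

lemma hull_phi_space_eq_iff:
  assumes P: "Theta X \<subseteq> P" "P \<subseteq> compact_convex X"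
    and F: "F \<in> lsubsets P" and K: "K \<in> P"
  shows "hull (phi_space X P) F = hull (phi_space X P) (lpoint P K) \<longleftrightarrow>
    (\<forall>A\<in>convex_sets X. lsub P F (phi X A) = lsub (points X) K A)"
proof -
  have "lsub P F (restrict (phi X A) P) = lsub P F (phi X A)" for A
    by (rule lsub_cong) auto
  moreover have "restrict (phi X A) P K = lsub (points X) K A" for A
    using K P(2) by (auto simp: phi_def)
  ultimately show ?thesis
    using hull_eq_hull_lpoint_iff[OF phi_space_lconvex_space[OF P], of F K] F K
    by (simp add: phi_space_def)
qed

text \<open>The weighted join \<open>G\<close> of the members of \<open>P\<close> satisfies
  \<open>lsub (points X) G A = lsub P F (phi X A)\<close> by residuation. Finiteness of
  \<open>F\<close> and compactness of each \<open>M\<close> make this degree commute with directed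
  joins; \<open>K\<close> is the hull of \<open>G\<close>.\<close>

lemma compact_representative:
  assumes P: "P \<subseteq> compact_convex X" and F: "lfinite P F" "lnonempty P F"
  obtains K where "K \<in> compact_convex X"
    "\<And>A. A \<in> convex_sets X \<Longrightarrow> lsub (points X) K A = lsub P F (phi X A)"
proof -
  define G where "G = (\<lambda>x\<in>points X. SUP M\<in>P. F M * M x)"
  have G_in: "G \<in> lsubsets (points X)"
    by (simp add: G_def)
  have phi: "phi X A M = lsub (points X) M A" if "M \<in> P" for A M
    using that P by (auto simp: phi_def)
  have G: "lsub (points X) G A = lsub P F (phi X A)" for A
  proof (rule eqI_lower)
    fix a :: 'l
    show "a \<le> lsub (points X) G A \<longleftrightarrow> a \<le> lsub P F (phi X A)"
      by (auto simp: le_lsub_iff G_def mult_SUP_le_iff phi ac_simps)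
  qed
  have "lnonempty (points X) G"
  proof -
    have "F M \<le> (SUP x\<in>points X. G x)" if M: "M \<in> P" for M
    proof -
      \<comment> \<open>A compact set is nonempty, so the second factor is 1.\<close>
      have "F M = F M * (SUP x\<in>points X. M x)"
        using M P by (auto simp: compact_convex_def)
      also have "\<dots> \<le> (SUP x\<in>points X. G x)"
        unfolding mult_SUP using M by (intro SUP_mono) (auto simp: G_def intro!: SUP_upper bexI)
      finally show ?thesis .
    qed
    then have "(SUP M\<in>P. F M) \<le> (SUP x\<in>points X. G x)"
      by (rule SUP_least)
    then show ?thesis
      using F(2) le_one antisym unfolding lnonempty_def by metis
  qed
  moreover have "lsub (points X) G (lJoin (points X) D) = (SUP C\<in>D. lsub (points X) G C)"
    if D: "D \<subseteq> convex_sets X" "directed_set D" for D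
  proof -
    define \<Phi> where "\<Phi> A = restrict (phi X A) P" for A
    have \<Phi>: "lsub P F (\<Phi> A) = lsub P F (phi X A)" for A
      by (rule lsub_cong) (auto simp: \<Phi>_def)
    have "directed_set (\<Phi> ` D)"
      by (rule directed_set_image[OF D(2)])
        (use phi in \<open>auto simp: \<Phi>_def le_fun_def intro!: lsub_mono\<close>)
    moreover have "\<Phi> ` D \<subseteq> lsubsets P"
      by (auto simp: \<Phi>_def)
    ultimately have "lsub P F (lJoin P (\<Phi> ` D)) = (SUP C\<in>\<Phi> ` D. lsub P F C)"
      using F(1) by (simp add: lfinite_def)
    \<comment> \<open>At each \<open>M\<close> in \<open>P\<close> this is compactness of
      \<open>M\<close> applied to \<open>D\<close>.\<close>
    moreover have "lsub P F (lJoin P (\<Phi> ` D)) = lsub P F (phi X (lJoin (points X) D))"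
      by (rule lsub_cong)
        (use P D in \<open>auto simp: lJoin_def[of P] \<Phi>_def phi compact_convex_def image_comp o_def\<close>)
    ultimately show ?thesis
      by (simp add: G \<Phi> image_comp o_def)
  qed
  ultimately have "hull X G \<in> compact_convex X"
    by (intro hull_compact_convex[OF X G_in])
  moreover have "lsub (points X) (hull X G) A = lsub P F (phi X A)" if "A \<in> convex_sets X" for A
    using that by (simp add: lsub_hull[OF X G_in] G)
  ultimately show thesis
    by (rule that)
qed

section \<open>Sobriety of \<open>XF X\<close>\<close>

lemma Theta_subset_XF_points: "Theta X \<subseteq> XF_points X"
  by (simp add: XF_points_def subset_F_closure)

lemma F_closed_XF_points: "F_closed (Cp X) (XF_points X)"
  unfolding XF_points_def
  by (rule F_closed_F_closure) (simp add: Cp_eq_phi_space Theta_subset_compact_convex[OF X])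

lemma XF_points_subset: "XF_points X \<subseteq> compact_convex X"
  using F_closed_XF_points by (simp add: F_closed_def Cp_eq_phi_space)

lemma sober_XF: "sober (XF X)"
  unfolding sober_def XF_eq_phi_space points_phi_space
proof (intro conjI allI impI)
  let ?P = "XF_points X" and ?Q = "compact_convex X"
  note P = Theta_subset_XF_points XF_points_subset
  note Q = Theta_subset_compact_convex[OF X] order_refl[of ?Q]
  show "lconvex_space (phi_space X ?P)"
    using P by (rule phi_space_lconvex_space)
  fix F :: "('a \<Rightarrow> 'l) \<Rightarrow> 'l" assume "lfinite ?P F \<and> lnonempty ?P F"
  then have F: "lfinite ?P F" "lnonempty ?P F" "F \<in> lsubsets ?P"
    by (auto simp: lfinite_def)
  obtain K where K: "K \<in> ?Q"
    "\<And>A. A \<in> convex_sets X \<Longrightarrow> lsub (points X) K A = lsub ?P F (phi X A)"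
    using compact_representative[OF P(2) F(1,2)] by blast
  \<comment> \<open>F-closedness of \<open>XF_points X\<close> refers to L-subsets of
    \<open>Cp X\<close>, so \<open>F\<close> is extended by \<open>bot\<close> to all compact sets.
    This keeps its degrees, hence \<open>K\<close> represents \<open>G\<close> as well and belongs
    to \<open>?P\<close>.\<close>
  define G where "G = lpush ?P id ?Q F"
  have fin: "lfinite ?Q G" "lnonempty ?Q G"
    unfolding G_def
    using lfinite_lpush[of ?P ?P id ?Q F] lnonempty_lpush[of ?P ?P id ?Q F] F P(2) by auto
  have "lsub ?Q G (phi X A) = lsub ?P F (phi X A)" for A
    unfolding G_def by (rule lsub_lpush) (use P(2) in auto)
  then have "hull (Cp X) G = hull (Cp X) (lpoint ?Q K)"
    using hull_phi_space_eq_iff[OF Q _ K(1), of G] K(2) fin(1)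
    by (simp add: Cp_eq_phi_space lfinite_def)
  moreover have "G \<le> lchar ?Q ?P"
    by (auto simp: le_fun_def G_def lpush_def lchar_def le_one intro!: SUP_least)
  ultimately have "K \<in> ?P"
    using F_closed_XF_points fin K(1) unfolding F_closed_def Cp_eq_phi_space points_phi_space
    by blast
  show "\<exists>!K. K \<in> ?P \<and> hull (phi_space X ?P) F = hull (phi_space X ?P) (lpoint ?P K)"
  proof (rule ex1I)
    show "K \<in> ?P \<and> hull (phi_space X ?P) F = hull (phi_space X ?P) (lpoint ?P K)"
      using \<open>K \<in> ?P\<close> K(2) hull_phi_space_eq_iff[OF P F(3)] by simp
    fix K' assume K': "K' \<in> ?P \<and> hull (phi_space X ?P) F = hull (phi_space X ?P) (lpoint ?P K')"
    then have "lsub (points X) K' A = lsub (points X) K A" if "A \<in> convex_sets X" for A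
      using that K(2) hull_phi_space_eq_iff[OF P F(3), of K'] by simp
    moreover have "K \<in> convex_sets X" "K' \<in> convex_sets X"
      using K(1) K' P(2) by (auto simp: compact_convex_def)
    ultimately show "K' = K"
      by (intro convex_eqI[OF X])
  qed
qed

section \<open>The map \<open>xi\<close> and its universal property\<close>

lemma xi_in_XF_points: "x \<in> points X \<Longrightarrow> xi X x \<in> XF_points X"
  using Theta_subset_XF_points by (auto simp: xi_def Theta_def)

lemma phi_eq_lsub: "K \<in> XF_points X \<Longrightarrow> phi X A K = lsub (points X) K A"
  using XF_points_subset by (auto simp: phi_def)

lemma phi_xi: "x \<in> points X \<Longrightarrow> A \<in> convex_sets X \<Longrightarrow> phi X A (xi X x) = A x"
  by (simp add: phi_eq_lsub xi_in_XF_points) (simp add: xi_def lsub_hull_lpoint[OF X])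

lemma convexity_preserving_xi: "convexity_preserving X (XF X) (xi X)"
proof -
  have "compose (points X) (restrict (phi X A) (XF_points X)) (xi X) = A"
    if "A \<in> convex_sets X" for A
    by (rule lsubsets_eqI[of _ "points X"])
      (use that in \<open>auto simp: compose_def xi_in_XF_points phi_xi convex_in_lsubsets[OF X]\<close>)
  moreover have "xi X \<in> points X \<rightarrow>\<^sub>E XF_points X"
    using xi_in_XF_points by (auto simp: xi_def)
  ultimately show ?thesis
    by (auto simp: convexity_preserving_def XF_def)
qed

lemma XF_points_representable:
  fixes Z :: "('z, 'l) lconv"
  assumes Z: "sober Z" and f: "convexity_preserving X Z f" and K: "K \<in> XF_points X"
  shows "\<exists>z\<in>points Z. \<forall>B\<in>convex_sets Z. B z = phi X (compose (points X) B f) K"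
proof -
  let ?Q = "compact_convex X"
  note Q = Theta_subset_compact_convex[OF X] order_refl[of ?Q]
  define S where "S = {K \<in> ?Q. \<exists>z\<in>points Z. \<forall>B\<in>convex_sets Z.
    B z = phi X (compose (points X) B f) K}"
  have S: "S \<subseteq> ?Q"
    by (auto simp: S_def)
  have fB: "compose (points X) B f \<in> convex_sets X" if "B \<in> convex_sets Z" for B
    using f that by (simp add: convexity_preserving_def)
  have f_in: "f x \<in> points Z" if "x \<in> points X" for x
    using f that by (auto simp: convexity_preserving_def)
  \<comment> \<open>For \<open>M = xi X x\<close> the required point of \<open>Z\<close> is
    \<open>f x\<close>.\<close>
  have "Theta X \<subseteq> S"
  proof
    fix M assume "M \<in> Theta X"
    then obtain x where x: "x \<in> points X" "M = xi X x"
      by (auto simp: Theta_def xi_def)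
    then have "B (f x) = phi X (compose (points X) B f) M" if "B \<in> convex_sets Z" for B
      using that by (simp add: phi_xi fB) (simp add: compose_def)
    then show "M \<in> S"
      using \<open>M \<in> Theta X\<close> Q(1) f_in[OF x(1)] by (auto simp: S_def)
  qed
  moreover have "F_closed (Cp X) S"
    unfolding F_closed_def Cp_eq_phi_space points_phi_space
  proof (intro conjI S allI ballI impI, elim conjE)
    fix F M assume M: "M \<in> ?Q" and F: "lfinite ?Q F" "lnonempty ?Q F" "F \<le> lchar ?Q S"
      and hull: "hull (phi_space X ?Q) F = hull (phi_space X ?Q) (lpoint ?Q M)"
    have "\<forall>N\<in>S. \<exists>z. z \<in> points Z \<and>
        (\<forall>B\<in>convex_sets Z. B z = phi X (compose (points X) B f) N)"
      by (auto simp: S_def)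
    from bchoice[OF this] obtain g where g: "\<And>N. N \<in> S \<Longrightarrow> g N \<in> points Z \<and>
        (\<forall>B\<in>convex_sets Z. B (g N) = phi X (compose (points X) B f) N)"
      by blast
    \<comment> \<open>The bound by \<open>lchar ?Q S\<close> places the support of \<open>F\<close>
      inside \<open>S\<close>, where \<open>g\<close> is specified; so the push-forward along
      \<open>g\<close> stays finite and nonempty, and sobriety of \<open>Z\<close> yields
      \<open>z\<close>.\<close>
    have supp: "F N = bot" if "N \<in> ?Q - S" for N
      using le_funD[OF F(3), of N] that by (simp add: lchar_def bot_unique)
    have maps: "g ` S \<subseteq> points Z"
      using g by auto
    obtain z where z: "z \<in> points Z"
      "\<And>B. B \<in> convex_sets Z \<Longrightarrow> lsub (points Z) (lpush S g (points Z) F) B = B z"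
      using sober_point[OF Z lfinite_lpush[OF S maps supp F(1)] lnonempty_lpush[OF S maps supp F(2)]]
      by blast
    have "B z = phi X (compose (points X) B f) M" if B: "B \<in> convex_sets Z" for B
    proof -
      \<comment> \<open>By the choice of \<open>g\<close>, the set \<open>B\<close> pulls back along
        \<open>g\<close> to \<open>phi X (compose (points X) B f)\<close> on
        \<open>S\<close>.\<close>
      have "B z = lsub ?Q F (phi X (compose (points X) B f))"
        unfolding z(2)[OF B, symmetric] by (rule lsub_lpush[OF S maps supp]) (use g B in auto)
      also have "\<dots> = lsub (points X) M (compose (points X) B f)"
        using hull hull_phi_space_eq_iff[OF Q _ M, of F] F(1) fB[OF B] by (simp add: lfinite_def)
      finally show ?thesis
        using M by (simp add: phi_def)
    qed
    then show "M \<in> S"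
      using M z(1) by (auto simp: S_def)
  qed
  ultimately have "XF_points X \<subseteq> S"
    unfolding XF_points_def by (intro F_closure_least)
  then show ?thesis
    using K by (auto simp: S_def)
qed

text \<open>The preimage of \<open>B\<close> under \<open>g\<close> is convex, hence of the form
  \<open>phi X A\<close> on \<open>XF_points X\<close>. Composing with \<open>xi X\<close> recovers
  \<open>A\<close>, so \<open>g\<close> enters only through its composite with
  \<open>xi X\<close>.\<close>

lemma extension_unique:
  assumes g: "convexity_preserving (XF X) Z g" and B: "B \<in> convex_sets Z" and K: "K \<in> XF_points X"
  shows "B (g K) = phi X (compose (points X) B (compose (points X) g (xi X))) K"
proof -
  have "compose (XF_points X) B g \<in> convex_sets (XF X)"
    using g B by (simp add: convexity_preserving_def XF_def)
  then obtain A where A: "A \<in> convex_sets X"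
    "compose (XF_points X) B g = restrict (phi X A) (XF_points X)"
    by (auto simp: XF_def)
  have eq: "B (g M) = phi X A M" if "M \<in> XF_points X" for M
    using fun_cong[OF A(2), of M] that by (simp add: compose_def)
  have "compose (points X) B (compose (points X) g (xi X)) = A"
    by (rule lsubsets_eqI[of _ "points X"])
      (use A(1) in \<open>auto simp: compose_def eq xi_in_XF_points phi_xi convex_in_lsubsets[OF X]\<close>)
  then show ?thesis
    using eq[OF K] by simp
qed

lemma XF_universal:
  assumes Z: "sober Z" and f: "convexity_preserving X Z f"
  shows "\<exists>!g. convexity_preserving (XF X) Z g \<and> f = compose (points X) g (xi X)"
proof -
  let ?P = "XF_points X"
  obtain h where h: "\<And>K. K \<in> ?P \<Longrightarrow> h K \<in> points Z \<and>
      (\<forall>B\<in>convex_sets Z. B (h K) = phi X (compose (points X) B f) K)"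
    using XF_points_representable[OF Z f] by metis
  define g where "g = restrict h ?P"
  have f_in: "f \<in> points X \<rightarrow>\<^sub>E points Z"
    and fB: "\<And>B. B \<in> convex_sets Z \<Longrightarrow> compose (points X) B f \<in> convex_sets X"
    using f by (auto simp: convexity_preserving_def)
  show ?thesis
  proof (rule ex1I)
    have "compose ?P B g = restrict (phi X (compose (points X) B f)) ?P"
      if "B \<in> convex_sets Z" for B
      using h that by (auto simp: compose_def g_def fun_eq_iff)
    then have "convexity_preserving (XF X) Z g"
      using h fB by (auto simp: convexity_preserving_def XF_def g_def)
    moreover have "f = compose (points X) g (xi X)"
    proof (rule PiE_ext[OF f_in])
      show "compose (points X) g (xi X) \<in> points X \<rightarrow>\<^sub>E points Z"
        using h xi_in_XF_points by (auto simp: compose_def g_def)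
      fix x assume x: "x \<in> points X"
      \<comment> \<open>Convex sets of \<open>Z\<close> take equal values at both points, and they
        separate points. Uniqueness of the extension below rests on the same argument.\<close>
      have "f x = h (xi X x)"
      proof (rule sober_point_eqI[OF Z])
        show "f x \<in> points Z" "h (xi X x) \<in> points Z"
          using x f_in h xi_in_XF_points by auto
        fix B assume B: "B \<in> convex_sets Z"
        have "B (f x) = phi X (compose (points X) B f) (xi X x)"
          using phi_xi[OF x fB[OF B]] x by (simp add: compose_eq)
        also have "\<dots> = B (h (xi X x))"
          using h[OF xi_in_XF_points[OF x]] B by simp
        finally show "B (f x) = B (h (xi X x))" .
      qed
      then show "f x = compose (points X) g (xi X) x"
        using x xi_in_XF_points by (simp add: compose_def g_def)
    qed
    ultimately show "convexity_preserving (XF X) Z g \<and> f = compose (points X) g (xi X)" ..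
    fix g' assume g': "convexity_preserving (XF X) Z g' \<and> f = compose (points X) g' (xi X)"
    then have g'_in: "g' \<in> ?P \<rightarrow>\<^sub>E points Z"
      by (simp add: convexity_preserving_def XF_def)
    show "g' = g"
    proof (rule PiE_ext[OF g'_in])
      show "g \<in> ?P \<rightarrow>\<^sub>E points Z"
        using h by (auto simp: g_def)
      fix K assume K: "K \<in> ?P"
      show "g' K = g K"
      proof (rule sober_point_eqI[OF Z])
        show "g' K \<in> points Z" "g K \<in> points Z"
          using g'_in h K by (auto simp: g_def)
        fix B assume "B \<in> convex_sets Z"
        then show "B (g' K) = B (g K)"
          using extension_unique[of Z g' B K] g' K h by (simp add: g_def)
      qed
    qed
  qed
qed

end

theorem theorem3p13:
  fixes X :: "('a, 'l::complete_residuated_lattice) lconv"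
  assumes "lconvex_space X"
  shows "sobrification TYPE('z) X (XF X) (xi X)"
  unfolding sobrification_def
  using assms sober_XF convexity_preserving_xi XF_universal by blast

end
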